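(* Let $g(x)$ be a formal power series with $g_0\neq0$, $g(x)\neq -1$, such that the Riordan array $(1,xg(x))$ is a pseudo-involution, i.e. $(1,xg(x))^{-1}=(1,xg(-x))$. Write $(1,xg(x))=(1,x\sqrt{g(x)})(1,xh(x))$ with $h(x)=s(x)+\sqrt{s^2(x)+1}$, where $s(x)$ is a power series whose even-index coefficients vanish. Let $B(x)=\sum_{i\ge0}b_ix^i$ be the generating function of the $B$-sequence of $(1,xg(x))$, i.e. the power series satisfying $$g(x)=1+xg(x)B\left(x^2g(x)\right).$$ Then $xB(x^2)=2s(x)$.
   Context: For formal power series $f(x)$ and $\phi(x)$ with $\phi_0=0$, the Riordan array $(f(x),\phi(x))$ is the infinite lower-triangular matrix whose $n$th column has generating function $f(x)\phi^n(x)$; it acts by $(f(x),\phi(x))a(x)=f(x)a(\phi(x))$ and products satisfy $(f,\phi)(b,\psi)=(f\cdot b(\phi),\psi(\phi))$. The array $(1,xg(x))$ is a pseudo-involution if $(1,xg(x))^{-1}=M(1,xg(x))M$ with $M=(1,-x)=\mathrm{diag}(1,-1,1,-1,\dots)$, equivalently $(1,xg(x))^{-1}=(1,xg(-x))$. The $B$-sequence $(b_0,b_1,\dots)$ of the matrix $(1,xg(x))$ with entries $d_{n,m}$ is defined by $d_{n+1,m}=d_{n,m-1}+\sum_{i\ge0}b_id_{n-i,m+i}$, which is equivalent to $g(x)=1+xg(x)B(x^2g(x))$. Square roots of power series with constant term $1$ denote the power series square root with constant term $1$; the factor $(1,xh(x))$ in the decomposition is determined by $g$ since $(1,x\sqrt{g(x)})$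 is invertible. *)

theory Defs
  imports "HOL-Computational_Algebra.Formal_Power_Series"
begin

definition riordan :: "'a::field_char_0 fps \<Rightarrow> 'a fps \<Rightarrow> nat \<Rightarrow> nat \<Rightarrow> 'a" where
  "riordan f \<phi> n k = fps_nth (f * \<phi> ^ k) n"

text \<open>Product of infinite lower-triangular matrices: the entries \<open>A n j\<close> with \<open>j > n\<close> vanish,
  so the sum over all \<open>j\<close> reduces to \<open>j \<le> n\<close>.\<close>

definition lt_mult :: "(nat \<Rightarrow> nat \<Rightarrow> 'a::field_char_0) \<Rightarrow> (nat \<Rightarrow> nat \<Rightarrow> 'a) \<Rightarrow> nat \<Rightarrow> nat \<Rightarrow> 'a" where
  "lt_mult A B n k = (\<Sum>j\<le>n. A n j * B j k)"

definition lt_one :: "nat \<Rightarrow> nat \<Rightarrow> 'a::field_char_0" where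
  "lt_one n k = (if n = k then 1 else 0)"

definition lt_inverse :: "(nat \<Rightarrow> nat \<Rightarrow> 'a::field_char_0) \<Rightarrow> (nat \<Rightarrow> nat \<Rightarrow> 'a) \<Rightarrow> bool" where
  "lt_inverse A B \<longleftrightarrow> lt_mult A B = lt_one \<and> lt_mult B A = lt_one"

definition pseudo_involution :: "'a::field_char_0 fps \<Rightarrow> bool" where
  "pseudo_involution g \<longleftrightarrow>
     lt_inverse (riordan 1 (fps_X * g)) (riordan 1 (fps_X * (g oo (- fps_X))))"

text \<open>The square root with constant term 1; meaningful only for series with constant term 1.\<close>

definition fps_sqrt1 :: "'a::field_char_0 fps \<Rightarrow> 'a fps" where
  "fps_sqrt1 a = fps_radical (\<lambda>_ _. 1) 2 a"

lemma fps_sqrt1_unique: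
  fixes a r :: "'a::field_char_0 fps"
  assumes "fps_nth a 0 = 1"
  shows "r = fps_sqrt1 a \<longleftrightarrow> r ^ 2 = a \<and> fps_nth r 0 = 1"
proof -
  have "fps_sqrt1 a ^ 2 = a" "fps_nth (fps_sqrt1 a) 0 = 1"
    using power_radical[of a "\<lambda>_ _. 1" 1] assms
    by (auto simp: fps_sqrt1_def numeral_2_eq_2)
  moreover have "r = fps_sqrt1 a" if "r ^ 2 = a" "fps_nth r 0 = 1"
    using radical_unique[of "\<lambda>_ _. 1" 1 a r] assms that
    by (simp add: fps_sqrt1_def numeral_2_eq_2)
  ultimately show ?thesis by blast
qed

definition riordan_decomposition ::
    "'a::field_char_0 fps \<Rightarrow> 'a fps \<Rightarrow> 'a fps \<Rightarrow> bool" where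
  "riordan_decomposition g h s \<longleftrightarrow>
     riordan 1 (fps_X * g) =
       lt_mult (riordan 1 (fps_X * fps_sqrt1 g)) (riordan 1 (fps_X * h)) \<and>
     h = s + fps_sqrt1 (s ^ 2 + 1) \<and>
     (\<forall>n. even n \<longrightarrow> fps_nth s n = 0)"

end

theory Submission
  imports Defs
begin

text \<open>
  Pseudo-involutivity says that \<open>\<iota> = -xg\<close> satisfies \<open>g \<cdot> (g \<circ> \<iota>) = 1\<close>, which together with \<open>g \<noteq> -1\<close>
  forces \<open>g(0) = 1\<close>. Put \<open>r = \<surd>g\<close> and \<open>u = xr\<close>. Then \<open>r \<circ> \<iota> = 1/r\<close>, hence \<open>u \<circ> \<iota> = -u\<close>: the change
  of variable \<open>u\<close> conjugates \<open>\<iota>\<close> to \<open>x \<mapsto> -x\<close>. The decomposition means \<open>h \<circ> u = r\<close>, so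
  \<open>h(x) h(-x) = 1\<close> and \<open>2s = h - 1/h\<close> is odd. As \<open>x\<^sup>2g = u\<^sup>2\<close> and \<open>xg = ur\<close>, the equation defining \<open>B\<close>
  reads \<open>r - 1/r = u B(u\<^sup>2)\<close>, which is \<open>2s = x B(x\<^sup>2)\<close> composed with \<open>u\<close>.
\<close>

text \<open>The entry sum is the very formula for coefficient \<open>n\<close> of
  \<open>b ^ k oo a\<close>; zero constant term of \<open>a\<close> lets the power leave the
  composition.\<close>

lemma lt_mult_riordan_1:
  fixes a b :: "'a::field_char_0 fps"
  assumes "fps_nth a 0 = 0"
  shows "lt_mult (riordan 1 a) (riordan 1 b) = riordan 1 (b oo a)"
proof (intro ext)
  fix n k
  have "lt_mult (riordan 1 a) (riordan 1 b) n k = fps_nth (b ^ k oo a) n"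
    by (simp add: lt_mult_def riordan_def fps_compose_nth atLeast0AtMost mult.commute)
  then show "lt_mult (riordan 1 a) (riordan 1 b) n k = riordan 1 (b oo a) n k"
    using assms by (simp add: riordan_def fps_compose_power)
qed

lemma riordan_1_inject:
  fixes a b :: "'a::field_char_0 fps"
  shows "riordan 1 a = riordan 1 b \<longleftrightarrow> a = b"
proof
  assume "riordan 1 a = riordan 1 b"
  then have "riordan 1 a n 1 = riordan 1 b n 1" for n by simp
  then show "a = b" by (simp add: riordan_def fps_eq_iff)
qed simp

lemma lt_one_eq_riordan: "(lt_one :: nat \<Rightarrow> nat \<Rightarrow> 'a::field_char_0) = riordan 1 fps_X"
  by (intro ext) (simp add: lt_one_def riordan_def fps_X_power_nth)

text \<open>Substituting \<open>fps_X * g\<close> into x g(-x) must give x; the inner sign moves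
  onto the substituted series, and a factor x cancels.\<close>

lemma pseudo_involution_imp_mult_compose:
  fixes g :: "'a::field_char_0 fps"
  assumes "pseudo_involution g"
  shows "g * (g oo (- (fps_X * g))) = 1"
proof -
  have "(fps_X * (g oo (- fps_X))) oo (fps_X * g) = fps_X"
    using assms
    by (simp add: pseudo_involution_def lt_inverse_def lt_mult_riordan_1 lt_one_eq_riordan
        riordan_1_inject)
  moreover have "(g oo (- fps_X)) oo (fps_X * g) = g oo ((- fps_X) oo (fps_X * g))"
    by (rule fps_compose_assoc [symmetric]) auto
  moreover have "(- fps_X) oo (fps_X * g) = - (fps_X * g)"
    by (simp add: fps_compose_uminus)
  ultimately have "fps_X * (g * (g oo (- (fps_X * g)))) = fps_X * 1"
    by (simp add: fps_compose_mult_distrib mult.assoc)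
  then show ?thesis
    using fps_X_neq_zero mult_left_cancel by blast
qed

lemma const_term_eq_1_if_mult_compose:
  fixes g :: "'a::field_char_0 fps"
  assumes inv: "g * (g oo (- (fps_X * g))) = 1" and neq: "g \<noteq> - 1"
  shows "fps_nth g 0 = 1"
proof (rule ccontr)
  assume "fps_nth g 0 \<noteq> 1"
  moreover have "fps_nth g 0 * fps_nth g 0 = 1"
    using arg_cong [OF inv, of "\<lambda>f. fps_nth f 0"] by simp
  ultimately have g0: "fps_nth g 0 = - 1"
    using square_eq_1_iff by blast
  txt \<open>If \<open>g = -1 + c x\<^sup>m + \<dots>\<close>, then so is \<open>g \<circ> \<iota>\<close>, and comparing coefficients of \<open>x\<^sup>m\<close> in
    \<open>g \<cdot> (g \<circ> \<iota>) = 1\<close> gives \<open>2c = 0\<close>.\<close>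
  define i where "i = - (fps_X * g)"
  define p where "p = g + 1"
  define m where "m = subdegree p"
  define q where "q = fps_shift m p"
  have "p \<noteq> 0" using neq by (simp add: p_def add_eq_0_iff2)
  then have q0: "fps_nth q 0 \<noteq> 0"
    by (simp add: q_def m_def)
  have "fps_nth p 0 = 0" by (simp add: p_def g0)
  have i0: "fps_nth i 0 = 0" by (simp add: i_def)
  have p: "p = q * fps_X ^ m"
    unfolding q_def m_def by (rule subdegree_decompose)
  have i_eq: "i = fps_X * (- g)" by (simp add: i_def)
  have pi: "p oo i = (q oo i) * (- g) ^ m * fps_X ^ m"
    using i0 by (simp add: p fps_compose_mult_distrib fps_compose_power [symmetric])
      (simp add: i_eq power_mult_distrib del: mult_minus_right)
  have "(p - 1) * ((p oo i) - 1) = 1"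
    using inv by (simp add: p_def i_def fps_compose_add_distrib)
  then have "p + (p oo i) = p * (p oo i)"
    by (simp add: algebra_simps)
  then have "(q + (q oo i) * (- g) ^ m) * fps_X ^ m = (q * (p oo i)) * fps_X ^ m"
    unfolding pi by (subst (asm) (1 2) p) (simp add: algebra_simps)
  then have "q + (q oo i) * (- g) ^ m = q * (p oo i)"
    by simp
  \<comment> \<open>As \<open>- g\<close> has constant term 1, both summands on the left have
    constant term \<open>fps_nth q 0\<close>; the right side has none, since \<open>p\<close> has
    none.\<close>
  from arg_cong [OF this, of "\<lambda>f. fps_nth f 0"] have "fps_nth q 0 + fps_nth q 0 = 0"
    using \<open>fps_nth p 0 = 0\<close> by (simp add: g0 fps_nth_power_0)
  then show False using q0 by (simp flip: mult_2)
qed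

lemma fps_sqrt1_power2:
  fixes a :: "'a::field_char_0 fps"
  assumes "fps_nth a 0 = 1"
  shows "fps_sqrt1 a ^ 2 = a"
  using fps_sqrt1_unique [OF assms] by blast

lemma fps_sqrt1_nth_0:
  fixes a :: "'a::field_char_0 fps"
  assumes "fps_nth a 0 = 1"
  shows "fps_nth (fps_sqrt1 a) 0 = 1"
  using fps_sqrt1_unique [OF assms] by blast

text \<open>With t the root, this is (t + s)(t - s) = t^2 - s^2 = 1. It supplies 2s = h - 1/h
  without division.\<close>

lemma sum_sqrt_mult_eq_1:
  fixes s h :: "'a::field_char_0 fps"
  assumes "h = s + fps_sqrt1 (s ^ 2 + 1)" "fps_nth s 0 = 0"
  shows "h * (h - 2 * s) = 1"
proof -
  have "fps_sqrt1 (s ^ 2 + 1) ^ 2 = s ^ 2 + 1"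
    using assms(2) by (intro fps_sqrt1_power2) (simp add: fps_nth_power_0)
  then show ?thesis
    unfolding assms(1) by (simp add: power2_eq_square algebra_simps)
qed

lemma fps_nth_compose_X_square:
  fixes A :: "'a::field_char_0 fps"
  shows "fps_nth (A oo fps_X ^ 2) n = (if even n then fps_nth A (n div 2) else 0)"
proof -
  have "fps_nth (A oo fps_X ^ 2) n = (\<Sum>i = 0..n. if n = 2 * i then fps_nth A i else 0)"
    by (auto simp: fps_compose_nth fps_X_power_nth simp flip: power_mult intro!: sum.cong)
  also have "\<dots> = (\<Sum>i = 0..n. if i = n div 2 then (if even n then fps_nth A i else 0) else 0)"
    by (intro sum.cong) auto
  finally show ?thesis by simp
qed

lemma odd_fps_eq_X_mult_compose_square:
  fixes s :: "'a::field_char_0 fps"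
  assumes "\<And>n. even n \<Longrightarrow> fps_nth s n = 0"
  shows "\<exists>B. fps_X * (B oo fps_X ^ 2) = s"
proof
  show "fps_X * (Abs_fps (\<lambda>n. fps_nth s (2 * n + 1)) oo fps_X ^ 2) = s"
    using assms
    by (auto simp: fps_eq_iff fps_nth_compose_X_square elim!: evenE oddE)
qed

lemma compose_X_square_inject:
  fixes A B :: "'a::field_char_0 fps"
  assumes "A oo fps_X ^ 2 = B oo fps_X ^ 2"
  shows "A = B"
proof (rule fps_ext)
  fix n
  show "fps_nth A n = fps_nth B n"
    using arg_cong [OF assms, of "\<lambda>f. fps_nth f (2 * n)"]
    by (simp add: fps_nth_compose_X_square)
qed

theorem theorem2:
  fixes g :: "'a::field_char_0 fps"
  assumes "fps_nth g 0 \<noteq> 0"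
    and "g \<noteq> -1"
    and "pseudo_involution g"
  shows "(\<exists>h s. riordan_decomposition g h s) \<and>
         (\<exists>!B. g = 1 + fps_X * g * (B oo (fps_X ^ 2 * g))) \<and>
         (\<forall>h s B. riordan_decomposition g h s \<longrightarrow>
            g = 1 + fps_X * g * (B oo (fps_X ^ 2 * g)) \<longrightarrow>
            fps_X * (B oo (fps_X ^ 2)) = 2 * s)"
proof -
  define i where "i = - (fps_X * g)"
  have i0: "fps_nth i 0 = 0" by (simp add: i_def)
  have inv: "g * (g oo i) = 1"
    using pseudo_involution_imp_mult_compose [OF assms(3)] by (simp add: i_def)
  then have g0: "fps_nth g 0 = 1"
    using const_term_eq_1_if_mult_compose assms(2) by (simp add: i_def)
  define r where "r = fps_sqrt1 g"
  have r2: "r * r = g" and r0: "fps_nth r 0 = 1"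
    using fps_sqrt1_power2 [OF g0] fps_sqrt1_nth_0 [OF g0]
    by (simp_all add: r_def power2_eq_square)
  then have "r \<noteq> 0" by auto
  define u where "u = fps_X * r"
  have u0: "fps_nth u 0 = 0" and u1: "fps_nth u 1 \<noteq> 0"
    by (simp_all add: u_def r0)
  have u2: "fps_X ^ 2 * g = u ^ 2"
    by (simp add: u_def power2_eq_square flip: r2)
  \<comment> \<open>The linear coefficient of \<open>u\<close> is 1, so identities may be checked
    after substituting \<open>u\<close>.\<close>
  have cancel: "a oo u = b oo u \<longleftrightarrow> a = b" for a b :: "'a fps"
    by (rule fps_compose_inj_right [OF u0 u1])

  have r_i: "r * (r oo i) = 1"
  proof -
    \<comment> \<open>The square is 1, and the constant term 1 excludes the root -1.\<close>
    have "(r * (r oo i)) ^ 2 = (r * r) * ((r * r) oo i)"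
      using i0 by (simp add: fps_compose_mult_distrib power2_eq_square)
    then have "(r * (r oo i)) ^ 2 = 1" by (simp add: r2 inv)
    moreover have "fps_nth (r * (r oo i)) 0 = 1" by (simp add: r0)
    ultimately show ?thesis
      using fps_sqrt1_unique [of 1 "r * (r oo i)"] fps_sqrt1_unique [of 1 "1 :: 'a fps"] by simp
  qed
  have u_i: "u oo i = - u"
  proof -
    have "u oo i = i * (r oo i)"
      using i0 by (simp add: u_def fps_compose_mult_distrib)
    also have "\<dots> = - (u * (r * (r oo i)))"
      by (simp add: i_def u_def algebra_simps flip: r2)
    finally show ?thesis by (simp add: r_i)
  qed

  have decomp: "riordan_decomposition g h s \<longleftrightarrow>
      h oo u = r \<and> h = s + fps_sqrt1 (s ^ 2 + 1) \<and> (\<forall>n. even n \<longrightarrow> fps_nth s n = 0)" for h s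
  proof -
    have "fps_X * g = (fps_X * h) oo u \<longleftrightarrow> u * r = u * (h oo u)"
      using u0 by (simp add: fps_compose_mult_distrib u_def mult.assoc r2)
    also have "\<dots> \<longleftrightarrow> h oo u = r"
      using u1 by auto
    finally show ?thesis
      using u0
      by (simp add: riordan_decomposition_def lt_mult_riordan_1 riordan_1_inject flip: r_def u_def)
  qed

  \<comment> \<open>An equivalence rather than an implication: besides the claimed identity, it
    reduces existence and uniqueness of \<open>B\<close> to the equation for
    \<open>2 * s\<close>.\<close>
  have B_iff: "g = 1 + fps_X * g * (B oo (fps_X ^ 2 * g)) \<longleftrightarrow> fps_X * (B oo fps_X ^ 2) = 2 * s"
    if "riordan_decomposition g h s" for h s B
  proof -
    from that have hu: "h oo u = r" and h: "h = s + fps_sqrt1 (s ^ 2 + 1)" and "fps_nth s 0 = 0"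
      by (auto simp: decomp)
    then have "(h * (h - 2 * s)) oo u = 1"
      using sum_sqrt_mult_eq_1 [of h s] by simp
    then have su: "r * (r - ((2 * s) oo u)) = 1"
      using u0 by (simp add: fps_compose_mult_distrib fps_compose_sub_distrib hu)
    have Bu: "(fps_X * (B oo fps_X ^ 2)) oo u = u * (B oo u ^ 2)"
      using u0
      by (simp add: fps_compose_mult_distrib fps_X_power_compose flip: fps_compose_assoc)
    have "g = 1 + fps_X * g * (B oo (fps_X ^ 2 * g)) \<longleftrightarrow> r * r = 1 + r * (u * (B oo u ^ 2))"
      unfolding u2 by (simp add: u_def mult_ac flip: r2)
    also have "\<dots> \<longleftrightarrow> r * (u * (B oo u ^ 2)) = r * ((2 * s) oo u)"
      using su by (auto simp: algebra_simps)
    also have "\<dots> \<longleftrightarrow> fps_X * (B oo fps_X ^ 2) = 2 * s"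
      using \<open>r \<noteq> 0\<close> by (simp add: cancel flip: Bu)
    finally show ?thesis .
  qed

  obtain h s where hs: "riordan_decomposition g h s"
  proof -
    \<comment> \<open>This choice is forced by \<open>h oo u = r\<close>.\<close>
    define h where "h = r oo fps_inv u"
    have "fps_nth (fps_inv u) 0 = 0" by (simp add: fps_inv_def)
    then have "h oo u = r oo (fps_inv u oo u)"
      using u0 by (simp add: h_def fps_compose_assoc)
    then have hu: "h oo u = r"
      by (simp add: fps_inv [OF u0 u1])
    have h0: "fps_nth h 0 = 1"
      by (simp add: h_def r0)
    define k where "k = h oo (- fps_X)"
    have "k oo u = h oo (u oo i)"
      using u0 by (simp add: k_def u_i fps_compose_uminus flip: fps_compose_assoc)
    also have "\<dots> = r oo i"
      using u0 i0 by (simp add: fps_compose_assoc hu)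
    finally have "(h * k) oo u = 1 oo u"
      using u0 by (simp add: fps_compose_mult_distrib hu r_i)
    then have hk: "h * k = 1" unfolding cancel .
    \<comment> \<open>\<open>s\<close> and \<open>t\<close> are the odd and even parts of
      \<open>h\<close>, because \<open>k\<close> is h(-x). Then t^2 - s^2 = h k = 1 identifies
      \<open>t\<close> as the required root.\<close>
    define s where "s = fps_const (1 / 2) * (h - k)"
    define t where "t = fps_const (1 / 2) * (h + k)"
    have half: "fps_const (1 / 2 :: 'a) * fps_const (1 / 2) * 4 = 1"
      by (simp add: numeral_fps_const)
    have st: "h = s + t"
      by (simp add: s_def t_def fps_eq_iff add_divide_distrib diff_divide_distrib)
    have "t ^ 2 - s ^ 2 = fps_const (1 / 2) * fps_const (1 / 2) * 4 * (h * k)"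
      by (simp add: s_def t_def power2_eq_square algebra_simps)
    then have "t ^ 2 = s ^ 2 + 1"
      unfolding half hk by (simp add: algebra_simps)
    moreover have "fps_nth t 0 = 1" "fps_nth s 0 = 0"
      by (simp_all add: s_def t_def k_def h0)
    ultimately have "t = fps_sqrt1 (s ^ 2 + 1)"
      using fps_sqrt1_unique [of "s ^ 2 + 1" t] by (simp add: fps_nth_power_0)
    moreover have "fps_nth s n = 0" if "even n" for n
      using that by (simp add: s_def k_def fps_compose_uminus')
    ultimately have "riordan_decomposition g h s"
      using hu st by (simp add: decomp)
    then show ?thesis by (rule that)
  qed

  have "fps_nth (2 * s) n = 0" if "even n" for n
    using hs that by (simp add: decomp numeral_fps_const)
  then obtain B where B: "fps_X * (B oo fps_X ^ 2) = 2 * s"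
    using odd_fps_eq_X_mult_compose_square by blast
  have "B' = B" if "fps_X * (B' oo fps_X ^ 2) = 2 * s" for B'
  proof (rule compose_X_square_inject)
    have "fps_X * (B' oo fps_X ^ 2) = fps_X * (B oo fps_X ^ 2)" using that B by simp
    then show "B' oo fps_X ^ 2 = B oo fps_X ^ 2"
      using fps_X_neq_zero mult_left_cancel by blast
  qed
  with B have "\<exists>!B. g = 1 + fps_X * g * (B oo (fps_X ^ 2 * g))"
    unfolding B_iff [OF hs] by blast
  then show ?thesis
    using hs B_iff by blast
qed

end
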